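(* Let $v: G \rightarrow [0,\infty[$ be a weight on a planar domain $G$. Suppose that for each $z \in G$ there is a bounded open set $U \subset G$ such that $z \in U$, $\partial U \subset E_v$, and $v$ is bounded away from $0$ on $\partial U$. Then $H^\infty_v(G)$ is a Banach space.
   Context: A planar domain is a (nonempty) open connected subset $G$ of $\mathbb{C}$. A weight on $G$ is an arbitrary function $v:G\to[0,\infty[$ (not assumed continuous, bounded, or strictly positive). $E_v:=\{z\in G : v(z)>0\}$. $\partial U$ is the boundary of $U$ in $\mathbb{C}$. $H(G)$ is the space of holomorphic functions on $G$. $H^\infty_v(G):=\{f\in H(G) : \|f\|_v:=\sup_{z\in G} v(z)|f(z)|<+\infty\}$, endowed with the seminorm $\|\cdot\|_v$; saying it is a Banach space means that $\|\cdot\|_v$ is a norm and is complete. *)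

theory Defs
  imports "HOL-Complex_Analysis.Complex_Analysis" "HOL-Library.Function_Algebras"
begin

definition planar_domain :: "complex set \<Rightarrow> bool" where
  "planar_domain G \<longleftrightarrow> G \<noteq> {} \<and> open G \<and> connected G"

(* Weights and functions on G are total functions; the values of a weight off G are irrelevant. *)
definition weight_on :: "complex set \<Rightarrow> (complex \<Rightarrow> real) \<Rightarrow> bool" where
  "weight_on G v \<longleftrightarrow> (\<forall>z\<in>G. 0 \<le> v z)"

definition weight_support :: "complex set \<Rightarrow> (complex \<Rightarrow> real) \<Rightarrow> complex set" where
  "weight_support G v = {z \<in> G. v z > 0}"

(* A function on G is represented by its extension by 0, so that equality in H(G) is
   equality in HOL and the pointwise operations of Function_Algebras are those of H(G). *)
definition holomorphic_space :: "complex set \<Rightarrow> (complex \<Rightarrow> complex) set" where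
  "holomorphic_space G = {f. f holomorphic_on G \<and> (\<forall>z. z \<notin> G \<longrightarrow> f z = 0)}"

(* The real supremum is meaningful only for f in weighted_space G v below,
   where finiteness of the supremum is expressed by bdd_above. *)
definition weighted_norm :: "complex set \<Rightarrow> (complex \<Rightarrow> real) \<Rightarrow> (complex \<Rightarrow> complex) \<Rightarrow> real" where
  "weighted_norm G v f = (SUP z\<in>G. v z * cmod (f z))"

definition weighted_space :: "complex set \<Rightarrow> (complex \<Rightarrow> real) \<Rightarrow> (complex \<Rightarrow> complex) set" where
  "weighted_space G v =
     {f \<in> holomorphic_space G. bdd_above ((\<lambda>z. v z * cmod (f z)) ` G)}"

definition fun_scale :: "complex \<Rightarrow> ('a \<Rightarrow> complex) \<Rightarrow> 'a \<Rightarrow> complex" where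
  "fun_scale c f = (\<lambda>x. c * f x)"

definition norm_on ::
  "(complex \<Rightarrow> 'a \<Rightarrow> 'a::ab_group_add) \<Rightarrow> 'a set \<Rightarrow> ('a \<Rightarrow> real) \<Rightarrow> bool" where
  "norm_on smul V N \<longleftrightarrow>
     (\<forall>x\<in>V. 0 \<le> N x) \<and>
     (\<forall>x\<in>V. N x = 0 \<longleftrightarrow> x = 0) \<and>
     (\<forall>c. \<forall>x\<in>V. N (smul c x) = cmod c * N x) \<and>
     (\<forall>x\<in>V. \<forall>y\<in>V. N (x + y) \<le> N x + N y)"

(* Metric_space demands nonnegativity and symmetry of the distance on the whole type;
   off V, where N is uncontrolled, the distance is therefore set to 0. *)
definition norm_dist :: "'a::ab_group_add set \<Rightarrow> ('a \<Rightarrow> real) \<Rightarrow> 'a \<Rightarrow> 'a \<Rightarrow> real" where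
  "norm_dist V N x y = (if x \<in> V \<and> y \<in> V then N (x - y) else 0)"

definition banach_space_on ::
  "(complex \<Rightarrow> 'a \<Rightarrow> 'a::ab_group_add) \<Rightarrow> 'a set \<Rightarrow> ('a \<Rightarrow> real) \<Rightarrow> bool" where
  "banach_space_on smul V N \<longleftrightarrow>
     vector_space smul \<and> module.subspace smul V \<and> norm_on smul V N \<and>
     Metric_space.mcomplete V (norm_dist V N)"

lemma vector_space_fun_scale: "vector_space fun_scale"
  by unfold_locales (auto simp: fun_scale_def algebra_simps fun_eq_iff)

lemma Metric_space_norm_dist:
  assumes "vector_space smul" "module.subspace smul V" "norm_on smul V N"
  shows "Metric_space V (norm_dist V N)"
proof -
  interpret vector_space smul by fact
  have diff: "x - y \<in> V" if "x \<in> V" "y \<in> V" for x y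
    by (rule subspace_diff[OF assms(2) that])
  from assms(3) have nonneg: "\<And>x. x \<in> V \<Longrightarrow> 0 \<le> N x"
    and zero: "\<And>x. x \<in> V \<Longrightarrow> N x = 0 \<longleftrightarrow> x = 0"
    and hom: "\<And>c x. x \<in> V \<Longrightarrow> N (smul c x) = cmod c * N x"
    and add: "\<And>x y. x \<in> V \<Longrightarrow> y \<in> V \<Longrightarrow> N (x + y) \<le> N x + N y"
    by (simp_all only: norm_on_def)
  have comm: "N (x - y) = N (y - x)" if "x \<in> V" "y \<in> V" for x y
  proof -
    have "smul (-1) (y - x) = x - y"
      by (simp only: scale_minus_left scale_one minus_diff_eq)
    thus ?thesis
      using hom[OF diff[OF that(2,1)], of "-1"] by simp
  qed
  have tri: "N (x - z) \<le> N (x - y) + N (y - z)" if "x \<in> V" "y \<in> V" "z \<in> V" for x y z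
    using add[OF diff[OF that(1,2)] diff[OF that(2,3)]] by simp
  show ?thesis
  proof
    show "0 \<le> norm_dist V N x y" for x y
      unfolding norm_dist_def by (simp add: nonneg diff)
    show "norm_dist V N x y = norm_dist V N y x" for x y
      unfolding norm_dist_def using comm[of x y] by presburger
    show "norm_dist V N x y = 0 \<longleftrightarrow> x = y" if "x \<in> V" "y \<in> V" for x y
      using zero[OF diff[OF that]] that by (simp add: norm_dist_def)
    show "norm_dist V N x z \<le> norm_dist V N x y + norm_dist V N y z"
      if "x \<in> V" "y \<in> V" "z \<in> V" for x y z
      using tri[OF that] that by (simp add: norm_dist_def)
  qed
qed

lemma banach_space_on_iff_Cauchy:
  assumes "vector_space smul" "module.subspace smul V" "norm_on smul V N"
  shows "banach_space_on smul V N \<longleftrightarrow>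
    (\<forall>f. (\<forall>n. f n \<in> V) \<and> (\<forall>e>0. \<exists>M. \<forall>m\<ge>M. \<forall>n\<ge>M. N (f m - f n) < e)
      \<longrightarrow> (\<exists>l\<in>V. (\<lambda>n. N (f n - l)) \<longlonglongrightarrow> 0))"
proof -
  interpret M: Metric_space V "norm_dist V N"
    using assms by (rule Metric_space_norm_dist)
  have lim: "limitin M.mtopology f l sequentially \<longleftrightarrow> l \<in> V \<and> (\<lambda>n. N (f n - l)) \<longlonglongrightarrow> 0"
    if f: "\<And>n. f n \<in> V" for f l
  proof (cases "l \<in> V")
    case True
    have "norm_dist V N (f n) l = N (f n - l)" for n
      using f True by (simp add: norm_dist_def)
    thus ?thesis
      using True f by (simp add: M.limitin_metric_dist_null)
  qed (auto simp: M.limitin_metric_dist_null)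
  have cau: "M.MCauchy f \<longleftrightarrow>
      (\<forall>n. f n \<in> V) \<and> (\<forall>e>0. \<exists>M. \<forall>m\<ge>M. \<forall>n\<ge>M. N (f m - f n) < e)" for f
  proof (cases "\<forall>n. f n \<in> V")
    case True
    hence "norm_dist V N (f m) (f n) = N (f m - f n)" for m n
      by (simp add: norm_dist_def)
    thus ?thesis
      using True by (simp add: M.MCauchy_def image_subset_iff)
  next
    case False
    thus ?thesis by (auto simp: M.MCauchy_def)
  qed
  have "banach_space_on smul V N \<longleftrightarrow>
      (\<forall>f. M.MCauchy f \<longrightarrow> (\<exists>l. limitin M.mtopology f l sequentially))"
    using assms by (simp add: banach_space_on_def M.mcomplete_def)
  also have "\<dots> \<longleftrightarrow> (\<forall>f. M.MCauchy f \<longrightarrow> (\<exists>l\<in>V. (\<lambda>n. N (f n - l)) \<longlonglongrightarrow> 0))"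
  proof (intro iff_allI imp_cong refl)
    fix f assume "M.MCauchy f"
    hence "f n \<in> V" for n by (simp add: cau)
    thus "(\<exists>l. limitin M.mtopology f l sequentially) \<longleftrightarrow>
        (\<exists>l\<in>V. (\<lambda>n. N (f n - l)) \<longlonglongrightarrow> 0)"
      by (simp add: lim Bex_def)
  qed
  finally show ?thesis by (simp only: cau)
qed

end

theory Submission
  imports Defs
begin

text \<open>
  The boundary condition on \<open>v\<close> has one consequence that carries the proof: evaluation at the
  points of some disc around any \<open>z \<in> G\<close> is uniformly bounded by a multiple of \<open>\<parallel>f\<parallel>\<^sub>v\<close>. Indeed, if
  \<open>v \<ge> c > 0\<close> on the boundary of a bounded open \<open>U \<subseteq> G\<close> whose boundary lies in \<open>G\<close>, then
  \<open>\<bar>f\<bar> \<le> \<parallel>f\<parallel>\<^sub>v / c\<close> on that boundary, and the maximum principle carries this bound to all of \<open>U\<close>,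
  however small \<open>v\<close> may be inside (lemma \<open>norm_le_weighted_norm_inside\<close>).

  Local control of point evaluations makes the space Banach (lemma \<open>banach_weighted_space\<close>). A
  function of seminorm \<open>0\<close> vanishes at every point, so the seminorm is a norm. A Cauchy sequence is
  locally uniformly Cauchy, so it has a locally uniform, hence holomorphic, limit \<open>g\<close>; letting
  \<open>m \<rightarrow> \<infinity>\<close> in \<open>v z \<bar>f\<^sub>n z - f\<^sub>m z\<bar> < \<epsilon>\<close> for each fixed \<open>z\<close> shows that \<open>g\<close> belongs to the space
  and that the convergence holds in the seminorm.
\<close>

lemma weighted_le_weighted_norm:
  assumes "f \<in> weighted_space G v" "z \<in> G"
  shows "v z * cmod (f z) \<le> weighted_norm G v f"
  using assms unfolding weighted_space_def weighted_norm_def by (auto intro: cSUP_upper)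

lemma weighted_norm_le:
  assumes "G \<noteq> {}" "\<And>z. z \<in> G \<Longrightarrow> v z * cmod (f z) \<le> B"
  shows "weighted_norm G v f \<le> B"
  unfolding weighted_norm_def using assms by (rule cSUP_least)

lemma weighted_spaceI:
  assumes "f holomorphic_on G" "\<And>z. z \<notin> G \<Longrightarrow> f z = 0"
    and "\<And>z. z \<in> G \<Longrightarrow> v z * cmod (f z) \<le> B"
  shows "f \<in> weighted_space G v"
  using assms unfolding weighted_space_def holomorphic_space_def by (auto intro: bdd_aboveI2 [where M = B])

lemma weighted_spaceD:
  assumes "f \<in> weighted_space G v"
  shows "f holomorphic_on G" "z \<notin> G \<Longrightarrow> f z = 0"
  using assms unfolding weighted_space_def holomorphic_space_def by auto

lemma weighted_triangle:
  assumes "weight_on G v" "f \<in> weighted_space G v" "g \<in> weighted_space G v" "z \<in> G"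
  shows "v z * cmod (f z + g z) \<le> weighted_norm G v f + weighted_norm G v g"
proof -
  have "v z * cmod (f z + g z) \<le> v z * cmod (f z) + v z * cmod (g z)"
    using assms(1,4) unfolding weight_on_def distrib_left [symmetric]
    by (intro mult_left_mono norm_triangle_ineq) auto
  also have "\<dots> \<le> weighted_norm G v f + weighted_norm G v g"
    by (intro add_mono weighted_le_weighted_norm assms)
  finally show ?thesis .
qed

lemma weighted_scale:
  assumes "f \<in> weighted_space G v" "z \<in> G"
  shows "v z * cmod (fun_scale c f z) \<le> cmod c * weighted_norm G v f"
proof -
  have "v z * cmod (fun_scale c f z) = cmod c * (v z * cmod (f z))"
    by (simp add: fun_scale_def norm_mult)
  also have "\<dots> \<le> cmod c * weighted_norm G v f"
    by (intro mult_left_mono weighted_le_weighted_norm assms) auto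
  finally show ?thesis .
qed

lemma subspace_weighted_space:
  assumes "weight_on G v"
  shows "module.subspace fun_scale (weighted_space G v)"
proof -
  interpret vector_space fun_scale
    by (rule vector_space_fun_scale)
  show ?thesis
  proof (rule subspaceI)
    show "0 \<in> weighted_space G v"
      by (rule weighted_spaceI[where B = 0]) (auto simp: zero_fun_def)
  next
    fix f g assume fg: "f \<in> weighted_space G v" "g \<in> weighted_space G v"
    show "f + g \<in> weighted_space G v"
    proof (rule weighted_spaceI)
      show "f + g holomorphic_on G"
        unfolding plus_fun_def by (intro holomorphic_on_add weighted_spaceD(1)[OF fg(1)] weighted_spaceD(1)[OF fg(2)])
      show "v z * cmod ((f + g) z) \<le> weighted_norm G v f + weighted_norm G v g" if "z \<in> G" for z
        using weighted_triangle[OF assms fg that] by simp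
    qed (simp add: weighted_spaceD(2)[OF fg(1)] weighted_spaceD(2)[OF fg(2)])
  next
    fix c f assume f: "f \<in> weighted_space G v"
    show "fun_scale c f \<in> weighted_space G v"
    proof (rule weighted_spaceI)
      show "fun_scale c f holomorphic_on G"
        unfolding fun_scale_def by (intro holomorphic_intros weighted_spaceD(1)[OF f])
      show "v z * cmod (fun_scale c f z) \<le> cmod c * weighted_norm G v f" if "z \<in> G" for z
        using weighted_scale[OF f that] .
    qed (simp add: fun_scale_def weighted_spaceD(2)[OF f])
  qed
qed

text \<open>
  Definiteness is the only norm axiom that can fail for a general weight: a function may live where
  \<open>v\<close> vanishes. A bound on point evaluations excludes this.
\<close>

lemma norm_on_weighted_space:
  assumes "G \<noteq> {}" "weight_on G v"
    and eval: "\<And>z. z \<in> G \<Longrightarrow>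
      \<exists>K. \<forall>f\<in>weighted_space G v. cmod (f z) \<le> K * weighted_norm G v f"
  shows "norm_on fun_scale (weighted_space G v) (weighted_norm G v)"
proof -
  interpret vector_space fun_scale
    by (rule vector_space_fun_scale)
  note sub = subspace_weighted_space[OF assms(2)]
  have nonneg: "0 \<le> weighted_norm G v f" if f: "f \<in> weighted_space G v" for f
  proof -
    from assms(1) obtain z where z: "z \<in> G" by blast
    have "0 \<le> v z * cmod (f z)"
      using assms(2) z by (simp add: weight_on_def)
    thus ?thesis
      using weighted_le_weighted_norm[OF f z] by linarith
  qed
  have definite: "f = 0" if f: "f \<in> weighted_space G v" and N0: "weighted_norm G v f = 0" for f
  proof
    fix z
    show "f z = 0 z"
    proof (cases "z \<in> G")
      case True
      then obtain K where "cmod (f z) \<le> K * weighted_norm G v f"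
        using eval f by blast
      thus ?thesis using N0 by simp
    qed (simp add: weighted_spaceD(2)[OF f])
  qed
  have zero: "weighted_norm G v 0 = 0"
    using assms(1) by (simp add: weighted_norm_def)
  have scale_le: "weighted_norm G v (fun_scale c f) \<le> cmod c * weighted_norm G v f"
    if "f \<in> weighted_space G v" for c f
    by (intro weighted_norm_le assms(1) weighted_scale that)
  have scale: "weighted_norm G v (fun_scale c f) = cmod c * weighted_norm G v f"
    if f: "f \<in> weighted_space G v" for c f
  proof (cases "c = 0")
    case False
    (* The reverse inequality is scale_le for the inverse scalar. *)
    have "weighted_norm G v f = weighted_norm G v (fun_scale (inverse c) (fun_scale c f))"
      using False by simp
    also have "\<dots> \<le> cmod (inverse c) * weighted_norm G v (fun_scale c f)"
      by (intro scale_le subspace_scale[OF sub] f)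
    finally have "cmod c * weighted_norm G v f \<le> weighted_norm G v (fun_scale c f)"
      using False by (simp add: norm_divide field_simps)
    thus ?thesis using scale_le[OF f, of c] by simp
  qed (simp add: zero)
  have triangle: "weighted_norm G v (f + g) \<le> weighted_norm G v f + weighted_norm G v g"
    if "f \<in> weighted_space G v" "g \<in> weighted_space G v" for f g
    using weighted_triangle[OF assms(2) that] by (intro weighted_norm_le assms(1)) simp
  show ?thesis
    unfolding norm_on_def using nonneg definite zero scale triangle by blast
qed

text \<open>
  Control on discs rather than at single points is what makes the limit holomorphic. Convergence in
  the seminorm then needs only pointwise limits, because a bound \<open>v z \<bar>F\<^sub>n z - F\<^sub>m z\<bar> \<le> \<epsilon>\<close> that is
  uniform in \<open>m\<close> and \<open>z\<close> survives \<open>m \<rightarrow> \<infinity>\<close> at each \<open>z\<close> separately.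
\<close>

lemma weighted_Cauchy_limit:
  assumes "open G" "G \<noteq> {}" "weight_on G v"
    and eval: "\<And>z. z \<in> G \<Longrightarrow> \<exists>d K. 0 < d \<and> cball z d \<subseteq> G \<and>
      (\<forall>f\<in>weighted_space G v. \<forall>w\<in>cball z d. cmod (f w) \<le> K * weighted_norm G v f)"
    and F: "\<And>n. F n \<in> weighted_space G v"
    and Cauchy: "\<And>e. 0 < e \<Longrightarrow> \<exists>M. \<forall>m\<ge>M. \<forall>n\<ge>M. weighted_norm G v (F m - F n) < e"
  shows "\<exists>g\<in>weighted_space G v. (\<lambda>n. weighted_norm G v (F n - g)) \<longlonglongrightarrow> 0"
proof -
  interpret vector_space fun_scale
    by (rule vector_space_fun_scale)
  note sub = subspace_weighted_space[OF assms(3)]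
  have diff: "F m - F n \<in> weighted_space G v" for m n
    by (intro subspace_diff[OF sub] F)
  have unif: "\<exists>d>0. cball z d \<subseteq> G \<and> uniformly_Cauchy_on (cball z d) F" if z: "z \<in> G" for z
  proof -
    obtain d K where d: "0 < d" "cball z d \<subseteq> G"
      and K: "\<And>f w. f \<in> weighted_space G v \<Longrightarrow> w \<in> cball z d \<Longrightarrow> cmod (f w) \<le> K * weighted_norm G v f"
      using eval[OF z] by blast
    have "uniformly_Cauchy_on (cball z d) F"
    proof (rule uniformly_Cauchy_onI)
      fix e :: real assume e: "0 < e"
      (* K may be negative or zero, hence the denominator. *)
      define e' where "e' = e / (\<bar>K\<bar> + 1)"
      have "0 < e'"
        using e unfolding e'_def by (intro divide_pos_pos) auto
      then obtain M where M: "\<forall>m\<ge>M. \<forall>n\<ge>M. weighted_norm G v (F m - F n) < e'"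
        using Cauchy by blast
      have "dist (F m w) (F n w) < e" if w: "w \<in> cball z d" and mn: "m \<ge> M" "n \<ge> M" for w m n
      proof -
        have "v z * cmod ((F m - F n) z) \<le> weighted_norm G v (F m - F n)"
          by (rule weighted_le_weighted_norm[OF diff z])
        moreover have "0 \<le> v z * cmod ((F m - F n) z)"
          using assms(3) z by (simp add: weight_on_def)
        ultimately have N0: "0 \<le> weighted_norm G v (F m - F n)"
          by linarith
        have "cmod ((F m - F n) w) \<le> K * weighted_norm G v (F m - F n)"
          by (rule K[OF diff w])
        also have "\<dots> \<le> (\<bar>K\<bar> + 1) * weighted_norm G v (F m - F n)"
          using N0 by (intro mult_right_mono) auto
        also have "\<dots> < (\<bar>K\<bar> + 1) * e'"
          using M mn by (intro mult_strict_left_mono) auto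
        also have "\<dots> = e"
          unfolding e'_def by simp
        finally show ?thesis
          by (simp add: dist_norm)
      qed
      thus "\<exists>M. \<forall>w\<in>cball z d. \<forall>m\<ge>M. \<forall>n\<ge>M. dist (F m w) (F n w) < e"
        by blast
    qed
    with d show ?thesis by blast
  qed
  define g where "g = (\<lambda>z. lim (\<lambda>n. F n z))"
  have unif_lim: "\<exists>d>0. cball z d \<subseteq> G \<and> uniform_limit (cball z d) F g sequentially"
    if z: "z \<in> G" for z
  proof -
    obtain d where d: "0 < d" "cball z d \<subseteq> G" "uniformly_Cauchy_on (cball z d) F"
      using unif[OF z] by blast
    have "uniformly_convergent_on (cball z d) F"
      by (rule Cauchy_uniformly_convergent[OF d(3)])
    hence "uniform_limit (cball z d) F g sequentially"
      unfolding g_def uniformly_convergent_uniform_limit_iff .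
    with d show ?thesis by blast
  qed
  have ptwise: "(\<lambda>n. F n z) \<longlonglongrightarrow> g z" if z: "z \<in> G" for z
    using unif_lim[OF z] by (auto intro: tendsto_uniform_limitI)
  have hol: "g holomorphic_on G"
    by (rule holomorphic_uniform_sequence[where f = F, OF assms(1) weighted_spaceD(1)[OF F]])
       (use unif_lim in blast)
  have zero: "g z = 0" if "z \<notin> G" for z
    using weighted_spaceD(2)[OF F that] by (simp add: g_def)
  have close: "\<exists>M. \<forall>n\<ge>M. \<forall>z\<in>G. v z * cmod ((F n - g) z) \<le> e" if e: "0 < e" for e
  proof -
    obtain M where M: "\<forall>m\<ge>M. \<forall>n\<ge>M. weighted_norm G v (F m - F n) < e"
      using Cauchy[OF e] by blast
    have "v z * cmod ((F n - g) z) \<le> e" if n: "n \<ge> M" and z: "z \<in> G" for n z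
    proof (rule tendsto_upperbound)
      show "(\<lambda>m. v z * cmod ((F n - F m) z)) \<longlonglongrightarrow> v z * cmod ((F n - g) z)"
        unfolding minus_apply by (intro tendsto_intros ptwise z)
      have "v z * cmod ((F n - F m) z) \<le> e" if "m \<ge> M" for m
        using weighted_le_weighted_norm[where f = "F n - F m", OF diff z] M n that by fastforce
      thus "\<forall>\<^sub>F m in sequentially. v z * cmod ((F n - F m) z) \<le> e"
        by (auto simp: eventually_sequentially)
    qed simp
    thus ?thesis by blast
  qed
  have diff_g: "\<exists>n. F n - g \<in> weighted_space G v"
  proof -
    obtain n where n: "\<And>z. z \<in> G \<Longrightarrow> v z * cmod ((F n - g) z) \<le> 1"
      using close[of 1] by auto
    have "F n - g \<in> weighted_space G v"
    proof (rule weighted_spaceI)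
      show "F n - g holomorphic_on G"
        unfolding fun_diff_def by (intro holomorphic_on_diff hol weighted_spaceD(1)[OF F])
    qed (use n zero weighted_spaceD(2)[OF F] in auto)
    thus ?thesis ..
  qed
  then obtain n where n: "F n - g \<in> weighted_space G v" ..
  have g: "g \<in> weighted_space G v"
    using subspace_diff[OF sub F[of n] n] by simp
  have "(\<lambda>n. weighted_norm G v (F n - g)) \<longlonglongrightarrow> 0"
  proof (rule LIMSEQ_I)
    fix e :: real assume e: "0 < e"
    obtain M where M: "\<forall>n\<ge>M. \<forall>z\<in>G. v z * cmod ((F n - g) z) \<le> e / 2"
      using close[of "e / 2"] e by auto
    have "norm (weighted_norm G v (F n - g) - 0) < e" if "n \<ge> M" for n
    proof -
      have "weighted_norm G v (F n - g) \<le> e / 2"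
        using M that by (intro weighted_norm_le assms(2)) auto
      moreover from assms(2) obtain z where z: "z \<in> G" by blast
      have "0 \<le> v z * cmod ((F n - g) z)"
        using assms(3) z by (simp add: weight_on_def)
      then have "0 \<le> weighted_norm G v (F n - g)"
        using weighted_le_weighted_norm[OF subspace_diff[OF sub F g] z] order_trans by blast
      ultimately show ?thesis using e by simp
    qed
    thus "\<exists>M. \<forall>n\<ge>M. norm (weighted_norm G v (F n - g) - 0) < e" by blast
  qed
  with g show ?thesis by blast
qed

lemma banach_weighted_space:
  assumes "open G" "G \<noteq> {}" "weight_on G v"
    and eval: "\<And>z. z \<in> G \<Longrightarrow> \<exists>d K. 0 < d \<and> cball z d \<subseteq> G \<and>
      (\<forall>f\<in>weighted_space G v. \<forall>w\<in>cball z d. cmod (f w) \<le> K * weighted_norm G v f)"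
  shows "banach_space_on fun_scale (weighted_space G v) (weighted_norm G v)"
proof -
  have point_eval: "\<exists>K. \<forall>f\<in>weighted_space G v. cmod (f z) \<le> K * weighted_norm G v f"
    if z: "z \<in> G" for z
  proof -
    obtain d K where "0 < d"
      "\<forall>f\<in>weighted_space G v. \<forall>w\<in>cball z d. cmod (f w) \<le> K * weighted_norm G v f"
      using eval[OF z] by blast
    thus ?thesis by (intro exI[of _ K]) auto
  qed
  have norm: "norm_on fun_scale (weighted_space G v) (weighted_norm G v)"
    by (rule norm_on_weighted_space[OF assms(2,3) point_eval])
  show ?thesis
    unfolding banach_space_on_iff_Cauchy[OF vector_space_fun_scale
        subspace_weighted_space[OF assms(3)] norm]
    using weighted_Cauchy_limit[OF assms] by blast
qed

text \<open>
  This is the maximum principle: the weight needs a lower bound only on the boundary of \<open>U\<close>, where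
  \<open>\<bar>f\<bar> \<le> v \<bar>f\<bar> / c\<close>, to control \<open>f\<close> on all of \<open>U\<close>.
\<close>

lemma norm_le_weighted_norm_inside:
  assumes "f \<in> weighted_space G v" "bounded U" "U \<subseteq> G" "frontier U \<subseteq> G"
    and "0 < c" "\<And>w. w \<in> frontier U \<Longrightarrow> c \<le> v w"
    and "z \<in> U"
  shows "cmod (f z) \<le> (1 / c) * weighted_norm G v f"
proof (rule maximum_modulus_frontier[OF _ _ assms(2) _ assms(7)])
  have cl: "closure U \<subseteq> G"
    using assms(3,4) closure_Un_frontier[of U] by blast
  note hol = weighted_spaceD(1)[OF assms(1)]
  show "f holomorphic_on interior U"
    using holomorphic_on_subset[OF hol] interior_subset assms(3) by blast
  show "continuous_on (closure U) f"
    using holomorphic_on_imp_continuous_on[OF hol] cl by (rule continuous_on_subset)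
  fix w assume w: "w \<in> frontier U"
  have "c * cmod (f w) \<le> v w * cmod (f w)"
    using assms(6)[OF w] by (intro mult_right_mono) auto
  also have "\<dots> \<le> weighted_norm G v f"
    using assms(1,4) w by (intro weighted_le_weighted_norm) auto
  finally show "cmod (f w) \<le> (1 / c) * weighted_norm G v f"
    using assms(5) by (simp add: field_simps)
qed

theorem proposition3p6:
  fixes G :: "complex set" and v :: "complex \<Rightarrow> real"
  assumes "planar_domain G"
    and "weight_on G v"
    and "\<forall>z\<in>G. \<exists>U. open U \<and> bounded U \<and> U \<subseteq> G \<and> z \<in> U \<and>
           frontier U \<subseteq> weight_support G v \<and>
           (\<exists>c::real. c > 0 \<and> (\<forall>w\<in>frontier U. c \<le> v w))"
  shows "banach_space_on fun_scale (weighted_space G v) (weighted_norm G v)"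
proof (rule banach_weighted_space)
  show "open G" "G \<noteq> {}"
    using assms(1) by (auto simp: planar_domain_def)
  show "weight_on G v" by (rule assms(2))
  fix z assume "z \<in> G"
  then obtain U c where U: "open U" "bounded U" "U \<subseteq> G" "z \<in> U"
      "frontier U \<subseteq> weight_support G v"
    and c: "0 < c" "\<And>w. w \<in> frontier U \<Longrightarrow> c \<le> v w"
    using assms(3) by meson
  have fr: "frontier U \<subseteq> G"
    using U(5) by (auto simp: weight_support_def)
  obtain d where d: "0 < d" "cball z d \<subseteq> U"
    using U(1,4) open_contains_cball by blast
  have "cmod (f w) \<le> (1 / c) * weighted_norm G v f"
    if "f \<in> weighted_space G v" "w \<in> cball z d" for f w
    using norm_le_weighted_norm_inside[OF that(1) U(2,3) fr c] that(2) d(2) by blast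
  with d U(3) show "\<exists>d K. 0 < d \<and> cball z d \<subseteq> G \<and>
      (\<forall>f\<in>weighted_space G v. \<forall>w\<in>cball z d. cmod (f w) \<le> K * weighted_norm G v f)"
    by (intro exI[of _ d] exI[of _ "1 / c"]) auto
qed

end
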